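(* Let $G$ be a group and consider relations among the symbols $h_{ij}(u)$ ($u\in G$, $1\leq i\neq j\leq n$). For $n\geq 3$ the relations (R0)--(R4) imply the relations (H1)--(H5). Moreover, for $n\geq 4$ the relations (R0)--(R3) are equivalent to the relations (H1)--(H5). (The relations are listed in the context. "Imply" means that in the free group on the symbols $h_{ij}(u)$ the normal closure of the relators of the first list contains that of the second; "equivalent" means that the two normal closures coincide.)
   Context: Let $G$ be a group. In all relations distinct letters $i,j,k,l$ denote distinct indices in $\{1,\dots,n\}$, all elements $a,b,u,v$ range over $G$, and $[x,y]=xyx^{-1}y^{-1}$. First list: (R0) $h_{ij}(1)=1$; (R1) $h_{ij}(a)h_{ji}(a)=1$; (R2) $h_{jk}(b)h_{ik}(a)h_{ij}(b)=h_{ik}(ab)$; (R3) $[h_{ij}(a),h_{kl}(b)]=1$; (R4) $h_{ij}(a)^{-1}=h_{ij}(a^{-1})$. Second list (the defining relations of Rehmann's group $H_n(G)$): (H1) $h_{ij}(u)h_{ji}(u)=1$; (H2) $h_{ij}(u)h_{ki}(u)h_{jk}(u)=1$; (H3) $h_{ij}(u)h_{ik}(v)h_{ij}(u)^{-1}=h_{ik}(uv)h_{ik}(u)^{-1}$; (H4) $h_{ij}(u)h_{kj}(v)h_{ij}(u)^{-1}=h_{kj}(vu)h_{kj}(u)^{-1}$; (H5) $[h_{ij}(u),h_{kl}(v)]=1$. *)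

theory Defs
  imports "HOL-Algebra.Algebra"
begin

section \<open>Free groups\<close>

text \<open>
  The free group on a set \<open>S\<close> consists of the reduced words over \<open>S \<times> {True, False}\<close>; the letter
  \<open>(x, True)\<close> stands for \<open>x\<close> and \<open>(x, False)\<close> for its formal inverse. The product is
  concatenation followed by free reduction.
\<close>

type_synonym 'x word = "('x \<times> bool) list"

definition inv_letter :: "'x \<times> bool \<Rightarrow> 'x \<times> bool" where
  "inv_letter a = (fst a, \<not> snd a)"

fun reduced :: "'x word \<Rightarrow> bool" where
  "reduced (a # b # w) \<longleftrightarrow> b \<noteq> inv_letter a \<and> reduced (b # w)"
| "reduced _ \<longleftrightarrow> True"

fun push_letter :: "'x \<times> bool \<Rightarrow> 'x word \<Rightarrow> 'x word" where
  "push_letter a [] = [a]"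
| "push_letter a (b # w) = (if b = inv_letter a then w else a # b # w)"

definition free_group :: "'x set \<Rightarrow> 'x word monoid" where
  "free_group S =
    \<lparr>carrier = {w. reduced w \<and> fst ` set w \<subseteq> S},
     monoid.mult = foldr push_letter,
     one = []\<rparr>"

definition free_gen :: "'x \<Rightarrow> 'x word" where
  "free_gen x = [(x, True)]"

lemma inv_letter_inv_letter [simp]: "inv_letter (inv_letter a) = a"
  by (simp add: inv_letter_def)

lemma fst_inv_letter [simp]: "fst (inv_letter a) = fst a"
  by (simp add: inv_letter_def)

lemma inv_letter_neq [simp]: "inv_letter a \<noteq> a" "a \<noteq> inv_letter a"
  by (auto simp: inv_letter_def prod_eq_iff)

lemma reduced_tl: "reduced (a # w) \<Longrightarrow> reduced w"
  by (cases w) auto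

lemma reduced_push: "reduced w \<Longrightarrow> reduced (push_letter a w)"
  by (cases w) (auto dest: reduced_tl)

lemma push_push_inv: "reduced w \<Longrightarrow> push_letter a (push_letter (inv_letter a) w) = w"
proof (cases w)
  case (Cons b v)
  assume "reduced w"
  with Cons show ?thesis by (cases v) auto
qed simp

lemma push_reduced: "reduced (a # w) \<Longrightarrow> push_letter a w = a # w"
  by (cases w) auto

lemma set_push: "set (push_letter a w) \<subseteq> insert a (set w)"
  by (cases w) auto

lemma reduced_foldr: "reduced w \<Longrightarrow> reduced (foldr push_letter v w)"
  by (induction v) (auto intro: reduced_push)

lemma set_foldr: "set (foldr push_letter v w) \<subseteq> set v \<union> set w"
proof (induction v)
  case (Cons a v)
  then show ?case using set_push[of a "foldr push_letter v w"] by auto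
qed simp

lemma foldr_push_Nil: "reduced w \<Longrightarrow> foldr push_letter w [] = w"
proof (induction w)
  case (Cons a w)
  then show ?case using reduced_tl[of a w] by (simp add: push_reduced del: split_paired_All)
qed simp

lemma foldr_push_push:
  assumes "reduced w"
  shows "foldr push_letter (push_letter a v) w = push_letter a (foldr push_letter v w)"
proof (cases v)
  case (Cons b u)
  then show ?thesis
    using push_push_inv[OF reduced_foldr[OF assms, of u], of a] by auto
qed simp

lemma foldr_push_assoc:
  assumes "reduced w"
  shows "foldr push_letter (foldr push_letter u v) w = foldr push_letter u (foldr push_letter v w)"
  using assms by (induction u) (simp_all add: foldr_push_push)

lemma foldr_push_inverse:
  "reduced w \<Longrightarrow> foldr push_letter (map inv_letter (rev u)) (foldr push_letter u w) = w"
proof (induction u)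
  case (Cons a u)
  then show ?case
    using push_push_inv[OF reduced_foldr[OF Cons.prems, of u], of "inv_letter a"] by simp
qed simp

theorem group_free_group: "group (free_group S)"
proof (rule groupI)
  fix x assume x: "x \<in> carrier (free_group S)"
  define y where "y = foldr push_letter (map inv_letter (rev x)) []"
  have "fst ` set y \<subseteq> S"
    using x image_mono[OF set_foldr[of "map inv_letter (rev x)" "[]"], of fst]
    by (auto simp: y_def free_group_def image_image)
  then have "y \<in> carrier (free_group S)"
    by (simp add: y_def free_group_def reduced_foldr)
  moreover have "foldr push_letter y x = []"
    using x foldr_push_inverse[of "[]" x]
    by (simp add: y_def free_group_def foldr_push_assoc foldr_push_Nil)
  ultimately show "\<exists>y\<in>carrier (free_group S). y \<otimes>\<^bsub>free_group S\<^esub> x = \<one>\<^bsub>free_group S\<^esub>"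
    by (auto simp: free_group_def)
next
  fix x y assume "x \<in> carrier (free_group S)" "y \<in> carrier (free_group S)"
  then show "x \<otimes>\<^bsub>free_group S\<^esub> y \<in> carrier (free_group S)"
    using set_foldr[of x y] by (fastforce simp: free_group_def reduced_foldr)
qed (auto simp: free_group_def foldr_push_assoc)

lemma free_gen_closed: "x \<in> S \<Longrightarrow> free_gen x \<in> carrier (free_group S)"
  by (simp add: free_group_def free_gen_def)

definition letter_val :: "('b, 'm) monoid_scheme \<Rightarrow> ('x \<Rightarrow> 'b) \<Rightarrow> 'x \<times> bool \<Rightarrow> 'b" where
  "letter_val K f a = (if snd a then f (fst a) else inv\<^bsub>K\<^esub> f (fst a))"

definition word_val :: "('b, 'm) monoid_scheme \<Rightarrow> ('x \<Rightarrow> 'b) \<Rightarrow> 'x word \<Rightarrow> 'b" where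
  "word_val K f w = foldr (\<lambda>a y. letter_val K f a \<otimes>\<^bsub>K\<^esub> y) w \<one>\<^bsub>K\<^esub>"

context
  fixes K :: "('b, 'm) monoid_scheme" (structure) and f :: "'x \<Rightarrow> 'b" and S :: "'x set"
  assumes K: "group K" and f: "f \<in> S \<rightarrow> carrier K"
begin

interpretation K: group K by (rule K)

lemma letter_val_closed: "fst a \<in> S \<Longrightarrow> letter_val K f a \<in> carrier K"
  using f by (auto simp: letter_val_def)

lemma word_val_closed: "fst ` set w \<subseteq> S \<Longrightarrow> word_val K f w \<in> carrier K"
  by (induction w) (auto simp: word_val_def letter_val_closed)

lemma letter_val_inv:
  "fst a \<in> S \<Longrightarrow> letter_val K f a \<otimes> letter_val K f (inv_letter a) = \<one>"
  using f by (auto simp: letter_val_def inv_letter_def Pi_iff)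

lemma word_val_push:
  assumes a: "fst a \<in> S" and w: "fst ` set w \<subseteq> S"
  shows "word_val K f (push_letter a w) = letter_val K f a \<otimes> word_val K f w"
proof (cases w)
  case Nil
  then show ?thesis by (simp add: word_val_def)
next
  case (Cons b v)
  have v: "word_val K f v \<in> carrier K"
    using w Cons by (intro word_val_closed) auto
  have Cons_val: "word_val K f (c # u) = letter_val K f c \<otimes> word_val K f u" for c u
    by (simp add: word_val_def)
  have "letter_val K f a \<otimes> (letter_val K f (inv_letter a) \<otimes> word_val K f v) = word_val K f v"
    using a v letter_val_inv[OF a] letter_val_closed[of a] letter_val_closed[of "inv_letter a"]
    by (simp flip: K.m_assoc)
  then show ?thesis
    by (simp add: Cons Cons_val)
qed

lemma word_val_foldr:
  assumes "fst ` set v \<subseteq> S" "fst ` set w \<subseteq> S"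
  shows "word_val K f (foldr push_letter v w) = word_val K f v \<otimes> word_val K f w"
  using assms(1)
proof (induction v)
  case Nil
  then show ?case using word_val_closed[OF assms(2)] by (simp add: word_val_def)
next
  case (Cons a v)
  have "fst ` set (foldr push_letter v w) \<subseteq> S"
    using set_foldr[of v w] Cons.prems assms(2) by fastforce
  then have "word_val K f (foldr push_letter (a # v) w)
      = letter_val K f a \<otimes> (word_val K f v \<otimes> word_val K f w)"
    using Cons by (simp add: word_val_push)
  moreover have "word_val K f (a # v) = letter_val K f a \<otimes> word_val K f v"
    by (simp add: word_val_def)
  ultimately show ?case
    using Cons.prems word_val_closed[OF assms(2)] word_val_closed[of v] letter_val_closed[of a]
    by (simp add: K.m_assoc)
qed

lemma word_val_hom: "word_val K f \<in> hom (free_group S) K"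
  by (rule homI) (auto simp: free_group_def word_val_closed word_val_foldr)

lemma word_val_free_gen: "x \<in> S \<Longrightarrow> word_val K f (free_gen x) = f x"
  using f by (auto simp: word_val_def free_gen_def letter_val_def Pi_iff)

end

lemma inv_free_gen:
  assumes "x \<in> S"
  shows "inv\<^bsub>free_group S\<^esub> free_gen x = [(x, False)]"
proof -
  interpret group "free_group S" by (rule group_free_group)
  have "[(x, False)] \<otimes>\<^bsub>free_group S\<^esub> free_gen x = \<one>\<^bsub>free_group S\<^esub>"
    by (simp add: free_group_def free_gen_def inv_letter_def)
  then show ?thesis
    by (rule inv_equality) (use assms in \<open>auto simp: free_group_def free_gen_def\<close>)
qed

text \<open>The universal property: maps on \<open>S\<close> extend uniquely to homomorphisms.\<close>

theorem free_group_universal: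
  assumes K: "group K" and f: "f \<in> S \<rightarrow> carrier K"
  shows "\<exists>\<phi>\<in>hom (free_group S) K. (\<forall>x\<in>S. \<phi> (free_gen x) = f x) \<and>
           (\<forall>\<psi>\<in>hom (free_group S) K. (\<forall>x\<in>S. \<psi> (free_gen x) = f x) \<longrightarrow>
              (\<forall>w\<in>carrier (free_group S). \<psi> w = \<phi> w))"
proof (intro bexI conjI ballI impI)
  show "word_val K f \<in> hom (free_group S) K"
    using K f by (rule word_val_hom)
  show "word_val K f (free_gen x) = f x" if "x \<in> S" for x
    using K f that by (rule word_val_free_gen)
  fix \<psi> w
  assume \<psi>: "\<psi> \<in> hom (free_group S) K" and gen: "\<forall>x\<in>S. \<psi> (free_gen x) = f x"
  interpret \<psi>: group_hom "free_group S" K \<psi>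
    using K \<psi> group_free_group by (simp add: group_hom_def group_hom_axioms_def)
  assume "w \<in> carrier (free_group S)"
  then show "\<psi> w = word_val K f w"
  proof (induction w)
    case Nil
    then show ?case using \<psi>.hom_one by (simp add: free_group_def word_val_def)
  next
    case (Cons a w)
    have red: "reduced (a # w)" and a: "fst a \<in> S"
      using Cons.prems by (auto simp: free_group_def)
    have w: "w \<in> carrier (free_group S)"
      using Cons.prems by (auto simp: free_group_def dest: reduced_tl)
    have a': "[a] \<in> carrier (free_group S)"
      using a by (auto simp: free_group_def)
    have "[a] \<otimes>\<^bsub>free_group S\<^esub> w = a # w"
      using red by (simp add: free_group_def push_reduced)
    then have "\<psi> (a # w) = \<psi> [a] \<otimes>\<^bsub>K\<^esub> \<psi> w"
      using \<psi>.hom_mult[OF a' w] by simp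
    moreover have "\<psi> [a] = letter_val K f a"
    proof (cases "snd a")
      case True
      then have "[a] = free_gen (fst a)" by (simp add: free_gen_def prod_eq_iff)
      then show ?thesis using gen a True by (simp add: letter_val_def)
    next
      case False
      then have "[a] = inv\<^bsub>free_group S\<^esub> free_gen (fst a)"
        using a by (simp add: inv_free_gen prod_eq_iff)
      then show ?thesis
        using gen a False free_gen_closed[OF a] by (simp add: letter_val_def)
    qed
    ultimately show ?case
      using Cons.IH[OF w] by (simp add: word_val_def)
  qed
qed

section \<open>Relators and normal closures\<close>

definition normal_closure :: "('a, 'm) monoid_scheme \<Rightarrow> 'a set \<Rightarrow> 'a set" where
  "normal_closure F R = \<Inter> {N. N \<lhd> F \<and> R \<subseteq> N}"

lemma normal_closure_least: "N \<lhd> F \<Longrightarrow> R \<subseteq> N \<Longrightarrow> normal_closure F R \<subseteq> N"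
  by (auto simp: normal_closure_def)

lemma normal_normal_closure:
  assumes "group F" and R: "R \<subseteq> carrier F"
  shows "normal_closure F R \<lhd> F" and "R \<subseteq> normal_closure F R"
proof -
  interpret group F by fact
  let ?\<N> = "{N. N \<lhd> F \<and> R \<subseteq> N}"
  have "carrier F \<lhd> F"
    by (simp add: normal_inv_iff subgroup_self)
  then have "carrier F \<in> ?\<N>" using R by simp
  then have "subgroup (\<Inter> ?\<N>) F"
    by (intro subgroups_Inter) (auto simp: normal_inv_iff)
  then show "normal_closure F R \<lhd> F"
    by (auto simp: normal_closure_def normal_inv_iff)
  show "R \<subseteq> normal_closure F R"
    by (auto simp: normal_closure_def)
qed

definition commutator :: "('a, 'm) monoid_scheme \<Rightarrow> 'a \<Rightarrow> 'a \<Rightarrow> 'a" where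
  "commutator F x y = x \<otimes>\<^bsub>F\<^esub> y \<otimes>\<^bsub>F\<^esub> inv\<^bsub>F\<^esub> x \<otimes>\<^bsub>F\<^esub> inv\<^bsub>F\<^esub> y"

text \<open>The relator of the relation \<open>x = y\<close>.\<close>

definition relator :: "('a, 'm) monoid_scheme \<Rightarrow> 'a \<Rightarrow> 'a \<Rightarrow> 'a" where
  "relator F x y = x \<otimes>\<^bsub>F\<^esub> inv\<^bsub>F\<^esub> y"

section \<open>The two lists of relations\<close>

definition h_symbols :: "('g, 'm) monoid_scheme \<Rightarrow> nat \<Rightarrow> (nat \<times> nat \<times> 'g) set" where
  "h_symbols G n = {(i, j, u). i \<in> {1..n} \<and> j \<in> {1..n} \<and> i \<noteq> j \<and> u \<in> carrier G}"

definition h_free :: "('g, 'm) monoid_scheme \<Rightarrow> nat \<Rightarrow> (nat \<times> nat \<times> 'g) word monoid" where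
  "h_free G n = free_group (h_symbols G n)"

definition hsym :: "nat \<Rightarrow> nat \<Rightarrow> 'g \<Rightarrow> (nat \<times> nat \<times> 'g) word" where
  "hsym i j u = free_gen (i, j, u)"

definition distinct_indices :: "nat \<Rightarrow> nat list \<Rightarrow> bool" where
  "distinct_indices n is \<longleftrightarrow> distinct is \<and> set is \<subseteq> {1..n}"

context
  fixes G :: "('g, 'm) monoid_scheme" and n :: nat
begin

private abbreviation (input) F where "F \<equiv> h_free G n"
private abbreviation (input) D where "D \<equiv> distinct_indices n"

definition R0 :: "(nat \<times> nat \<times> 'g) word set" where
  "R0 = {relator F (hsym i j \<one>\<^bsub>G\<^esub>) \<one>\<^bsub>F\<^esub> | i j. D [i, j]}"

definition R1 :: "(nat \<times> nat \<times> 'g) word set" where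
  "R1 = {relator F (hsym i j a \<otimes>\<^bsub>F\<^esub> hsym j i a) \<one>\<^bsub>F\<^esub> | i j a. D [i, j] \<and> a \<in> carrier G}"

definition R2 :: "(nat \<times> nat \<times> 'g) word set" where
  "R2 = {relator F (hsym j k b \<otimes>\<^bsub>F\<^esub> hsym i k a \<otimes>\<^bsub>F\<^esub> hsym i j b) (hsym i k (a \<otimes>\<^bsub>G\<^esub> b)) | i j k a b.
           D [i, j, k] \<and> a \<in> carrier G \<and> b \<in> carrier G}"

definition R3 :: "(nat \<times> nat \<times> 'g) word set" where
  "R3 = {relator F (commutator F (hsym i j a) (hsym k l b)) \<one>\<^bsub>F\<^esub> | i j k l a b.
           D [i, j, k, l] \<and> a \<in> carrier G \<and> b \<in> carrier G}"

definition R4 :: "(nat \<times> nat \<times> 'g) word set" where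
  "R4 = {relator F (inv\<^bsub>F\<^esub> hsym i j a) (hsym i j (inv\<^bsub>G\<^esub> a)) | i j a. D [i, j] \<and> a \<in> carrier G}"

definition H1 :: "(nat \<times> nat \<times> 'g) word set" where
  "H1 = {relator F (hsym i j u \<otimes>\<^bsub>F\<^esub> hsym j i u) \<one>\<^bsub>F\<^esub> | i j u. D [i, j] \<and> u \<in> carrier G}"

definition H2 :: "(nat \<times> nat \<times> 'g) word set" where
  "H2 = {relator F (hsym i j u \<otimes>\<^bsub>F\<^esub> hsym k i u \<otimes>\<^bsub>F\<^esub> hsym j k u) \<one>\<^bsub>F\<^esub> | i j k u.
           D [i, j, k] \<and> u \<in> carrier G}"

definition H3 :: "(nat \<times> nat \<times> 'g) word set" where
  "H3 = {relator F (hsym i j u \<otimes>\<^bsub>F\<^esub> hsym i k v \<otimes>\<^bsub>F\<^esub> inv\<^bsub>F\<^esub> hsym i j u)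
           (hsym i k (u \<otimes>\<^bsub>G\<^esub> v) \<otimes>\<^bsub>F\<^esub> inv\<^bsub>F\<^esub> hsym i k u) | i j k u v.
           D [i, j, k] \<and> u \<in> carrier G \<and> v \<in> carrier G}"

definition H4 :: "(nat \<times> nat \<times> 'g) word set" where
  "H4 = {relator F (hsym i j u \<otimes>\<^bsub>F\<^esub> hsym k j v \<otimes>\<^bsub>F\<^esub> inv\<^bsub>F\<^esub> hsym i j u)
           (hsym k j (v \<otimes>\<^bsub>G\<^esub> u) \<otimes>\<^bsub>F\<^esub> inv\<^bsub>F\<^esub> hsym k j u) | i j k u v.
           D [i, j, k] \<and> u \<in> carrier G \<and> v \<in> carrier G}"

definition H5 :: "(nat \<times> nat \<times> 'g) word set" where
  "H5 = {relator F (commutator F (hsym i j u) (hsym k l v)) \<one>\<^bsub>F\<^esub> | i j k l u v.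
           D [i, j, k, l] \<and> u \<in> carrier G \<and> v \<in> carrier G}"

end

end

theory Submission
  imports Defs
begin

text \<open>
  Everything is computed in the quotient of the free group by a normal subgroup. For \<open>a = 1\<close>, (R2)
  becomes \<open>h_jk(b) h_ij(b) = h_ik(b)\<close>. This turns (R2) into (H4), read with \<open>h_kj\<close>, and into the
  conjugation rule
  \<open>h_ij(b)\<^sup>-\<^sup>1 h_ik(a) h_ij(b) = h_ik(b)\<^sup>-\<^sup>1 h_ik(ab)\<close>, which under (R4) is (H3). Without (R4), which in
  general does not follow from (R0)--(R3), this rule applied twice shows that
  \<open>z = h_ik(u\<^sup>-\<^sup>1) h_ik(u)\<close> commutes with every \<open>h_ij(d)\<close> and that
  \<open>h_ij(u)\<^sup>-\<^sup>1 h_ik(u) = h_ik(u) h_ij(u)\<^sup>-\<^sup>1 z = h_jk(u) z\<close>. With a fourth index \<open>l\<close>, (R3) makes the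
  latter commute with \<open>h_il(v)\<close>, and (H3) follows by writing \<open>h_ik(v) = h_lk(v) h_il(v)\<close>.
  Conversely, (R0) is (H3) with \<open>u = v = 1\<close>, and (R2) follows from (H1), (H2) and (H4).
\<close>

section \<open>Auxiliary indices and identities in groups\<close>

lemma distinct_indices_extend:
  assumes "distinct_indices n is" and "length is < n"
  obtains l where "distinct_indices n (l # is)"
proof -
  have "card (set is) < card {1..n}"
    using assms by (simp add: distinct_indices_def distinct_card)
  then have "\<not> {1..n} \<subseteq> set is"
    by (meson List.finite_set card_mono not_le)
  then obtain l where "l \<in> {1..n}" "l \<notin> set is"
    by blast
  then show ?thesis
    using assms(1) by (intro that[of l]) (simp add: distinct_indices_def)
qed

context group
begin

lemma inv_mult_cancel: "x \<in> carrier G \<Longrightarrow> y \<in> carrier G \<Longrightarrow> inv x \<otimes> (x \<otimes> y) = y"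
  by (simp flip: m_assoc)

lemma mult_inv_cancel: "x \<in> carrier G \<Longrightarrow> y \<in> carrier G \<Longrightarrow> x \<otimes> (inv x \<otimes> y) = y"
  by (simp flip: m_assoc)

text \<open>A complete rewrite system for identities of free groups.\<close>

lemmas group_simps = m_assoc inv_mult_group inv_mult_cancel mult_inv_cancel

lemma eq_mult_inv_iff:
  "x \<in> carrier G \<Longrightarrow> y \<in> carrier G \<Longrightarrow> z \<in> carrier G \<Longrightarrow> x = y \<otimes> inv z \<longleftrightarrow> x \<otimes> z = y"
  by (auto simp: group_simps)

lemma commute_inv:
  assumes "x \<in> carrier G" "y \<in> carrier G" "x \<otimes> y = y \<otimes> x"
  shows "inv x \<otimes> y = y \<otimes> inv x"
proof -
  have "inv x \<otimes> (x \<otimes> y) \<otimes> inv x = inv x \<otimes> (y \<otimes> x) \<otimes> inv x"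
    by (simp only: assms(3))
  then show ?thesis
    using assms(1,2) by (simp add: group_simps)
qed

lemma commutator_eq_one_iff:
  assumes "x \<in> carrier G" "y \<in> carrier G"
  shows "commutator G x y = \<one> \<longleftrightarrow> x \<otimes> y = y \<otimes> x"
proof -
  have "commutator G x y = (x \<otimes> y) \<otimes> inv (y \<otimes> x)"
    using assms by (simp add: commutator_def group_simps)
  then show ?thesis
    using assms by (metis eq_mult_inv_iff l_one m_closed one_closed)
qed

end

section \<open>Families in an arbitrary group: from (R0)--(R3) to (H2), (H3), (H4)\<close>

locale symbol_family = group Q + G: group G
  for Q :: "('q, 'k) monoid_scheme" (structure) and G :: "('g, 'm) monoid_scheme" +
  fixes n :: nat and h :: "nat \<Rightarrow> nat \<Rightarrow> 'g \<Rightarrow> 'q"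
  assumes h_closed: "distinct_indices n [i, j] \<Longrightarrow> u \<in> carrier G \<Longrightarrow> h i j u \<in> carrier Q"

locale R_family = symbol_family +
  assumes R0: "distinct_indices n [i, j] \<Longrightarrow> h i j \<one>\<^bsub>G\<^esub> = \<one>"
    and R1: "distinct_indices n [i, j] \<Longrightarrow> a \<in> carrier G \<Longrightarrow> h i j a \<otimes> h j i a = \<one>"
    and R2: "distinct_indices n [i, j, k] \<Longrightarrow> a \<in> carrier G \<Longrightarrow> b \<in> carrier G \<Longrightarrow>
      h j k b \<otimes> h i k a \<otimes> h i j b = h i k (a \<otimes>\<^bsub>G\<^esub> b)"
    and R3: "distinct_indices n [i, j, k, l] \<Longrightarrow> a \<in> carrier G \<Longrightarrow> b \<in> carrier G \<Longrightarrow>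
      h i j a \<otimes> h k l b = h k l b \<otimes> h i j a"
begin

lemma h_triangle:
  assumes "distinct_indices n [i, j, k]" "b \<in> carrier G"
  shows "h j k b \<otimes> h i j b = h i k b"
proof -
  have [simp]: "distinct_indices n [i, j]" "distinct_indices n [j, k]" "distinct_indices n [i, k]"
    using assms by (auto simp: distinct_indices_def)
  show ?thesis
    using R2[OF assms(1) G.one_closed assms(2)] assms(2) by (simp add: R0 h_closed)
qed

text \<open>By the triangle rule the first two factors multiply to \<open>h k j u\<close>, which
  (R1) cancels against \<open>h j k u\<close>.\<close>

lemma H2:
  assumes "distinct_indices n [i, j, k]" "u \<in> carrier G"
  shows "h i j u \<otimes> h k i u \<otimes> h j k u = \<one>"
proof -
  have "distinct_indices n [k, i, j]" "distinct_indices n [k, j]"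
    using assms by (auto simp: distinct_indices_def)
  then show ?thesis
    using assms(2) by (simp add: h_triangle R1)
qed

text \<open>In (R2) for the indices \<open>k, i, j\<close>, the last factor is
  \<open>h k i u = inv h i j u \<otimes> h k j u\<close> by the triangle rule; cancelling
  \<open>h k j u\<close> on the right leaves the claim.\<close>

lemma H4:
  assumes D: "distinct_indices n [i, j, k]" and [simp]: "u \<in> carrier G" "v \<in> carrier G"
  shows "h i j u \<otimes> h k j v \<otimes> inv h i j u = h k j (v \<otimes>\<^bsub>G\<^esub> u) \<otimes> inv h k j u"
proof -
  have D': "distinct_indices n [k, i, j]"
    and [simp]: "distinct_indices n [i, j]" "distinct_indices n [k, j]" "distinct_indices n [k, i]"
    using D by (auto simp: distinct_indices_def)
  show ?thesis
    by (simp add: h_closed group_simps flip: R2[OF D', of v u] h_triangle[OF D', of u])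
qed

text \<open>Here the first factor of (R2) is eliminated instead: the triangle rule gives
  \<open>h j k b = h i k b \<otimes> inv h i j b\<close>.\<close>

lemma conj_h:
  assumes D: "distinct_indices n [i, j, k]" and [simp]: "a \<in> carrier G" "b \<in> carrier G"
  shows "inv h i j b \<otimes> h i k a \<otimes> h i j b = inv h i k b \<otimes> h i k (a \<otimes>\<^bsub>G\<^esub> b)"
proof -
  have [simp]: "distinct_indices n [i, j]" "distinct_indices n [i, k]" "distinct_indices n [j, k]"
    using D by (auto simp: distinct_indices_def)
  show ?thesis
    by (simp add: h_closed group_simps flip: R2[OF D, of a b] h_triangle[OF D, of b])
qed

text \<open>With both arguments inverted, (R4) turns \<open>conj_h\<close> into the inverse of the
  desired equation.\<close>

lemma H3_of_R4:
  assumes R4: "\<And>i j a. distinct_indices n [i, j] \<Longrightarrow> a \<in> carrier G \<Longrightarrow>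
      inv h i j a = h i j (inv\<^bsub>G\<^esub> a)"
    and D: "distinct_indices n [i, j, k]" and [simp]: "u \<in> carrier G" "v \<in> carrier G"
  shows "h i j u \<otimes> h i k v \<otimes> inv h i j u = h i k (u \<otimes>\<^bsub>G\<^esub> v) \<otimes> inv h i k u"
proof -
  have [simp]: "distinct_indices n [i, j]" "distinct_indices n [i, k]"
    using D by (auto simp: distinct_indices_def)
  have "inv (h i j u \<otimes> h i k v \<otimes> inv h i j u) = inv (h i k (u \<otimes>\<^bsub>G\<^esub> v) \<otimes> inv h i k u)"
    using conj_h[OF D, of "inv\<^bsub>G\<^esub> v" "inv\<^bsub>G\<^esub> u"]
    by (simp add: h_closed group_simps R4 G.inv_mult_group)
  then show ?thesis
    by (simp add: h_closed inv_inj[THEN inj_onD])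
qed

text \<open>The element \<open>z\<close> measures the failure of (R4): it is trivial exactly if
  \<open>inv h i k b\<close> equals the symbol of the inverse of \<open>b\<close>. Conjugation by
  \<open>z\<close> is conjugation by its two factors in turn; \<open>conj_h\<close> shifts the
  argument \<open>d\<close> first by the inverse of \<open>b\<close>, then by \<open>b\<close>, so
  \<open>h i j d\<close> is fixed.\<close>

lemma h_inverse_pair_commute:
  assumes D: "distinct_indices n [i, j, k]" and [simp]: "b \<in> carrier G" "d \<in> carrier G"
  defines "z \<equiv> h i k (inv\<^bsub>G\<^esub> b) \<otimes> h i k b"
  shows "z \<otimes> h i j d = h i j d \<otimes> z"
proof -
  have D': "distinct_indices n [i, k, j]"
    and [simp]: "distinct_indices n [i, j]" "distinct_indices n [i, k]"
    using D by (auto simp: distinct_indices_def)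
  let ?b = "inv\<^bsub>G\<^esub> b"
  have z [simp]: "z \<in> carrier Q"
    by (simp add: z_def h_closed)
  have "inv z \<otimes> h i j d \<otimes> z =
      inv h i k b \<otimes> (inv h i k ?b \<otimes> h i j d \<otimes> h i k ?b) \<otimes> h i k b"
    by (simp add: z_def h_closed group_simps)
  also have "\<dots> = inv h i k b \<otimes> (inv h i j ?b \<otimes> h i j (d \<otimes>\<^bsub>G\<^esub> ?b)) \<otimes> h i k b"
    by (simp add: conj_h[OF D'])
  also have "\<dots> = inv (inv h i k b \<otimes> h i j ?b \<otimes> h i k b)
      \<otimes> (inv h i k b \<otimes> h i j (d \<otimes>\<^bsub>G\<^esub> ?b) \<otimes> h i k b)"
    by (simp add: h_closed group_simps)
  \<comment> \<open>In the first bracket the arguments multiply to 1, so by (R0) its inverse is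
    \<open>h i j b\<close>; the second bracket is
    \<open>inv h i j b \<otimes> h i j d\<close>.\<close>
  also have "\<dots> = h i j d"
    by (simp only: conj_h[OF D'] G.inv_closed G.m_closed assms(2,3))
      (simp add: h_closed group_simps R0 G.m_assoc)
  finally have "z \<otimes> (inv z \<otimes> h i j d \<otimes> z) = z \<otimes> h i j d"
    by simp
  then show ?thesis
    by (simp add: h_closed group_simps)
qed

lemma H3_of_four_indices:
  assumes D: "distinct_indices n [l, i, j, k]" and [simp]: "u \<in> carrier G" "v \<in> carrier G"
  shows "h i j u \<otimes> h i k v \<otimes> inv h i j u = h i k (u \<otimes>\<^bsub>G\<^esub> v) \<otimes> inv h i k u"
proof -
  have D': "distinct_indices n [i, j, k]" "distinct_indices n [i, l, k]"
      "distinct_indices n [i, j, l, k]" "distinct_indices n [i, l, j, k]"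
    and [simp]: "distinct_indices n [i, j]" "distinct_indices n [i, k]" "distinct_indices n [i, l]"
      "distinct_indices n [j, k]" "distinct_indices n [l, k]"
    using D by (auto simp: distinct_indices_def)
  define z where "z = h i k (inv\<^bsub>G\<^esub> u) \<otimes> h i k u"
  define xj xk xl where x_defs: "xj = h i j u" "xk = h i k u" "xl = h i l v"
  have [simp]: "z \<in> carrier Q" "xj \<in> carrier Q" "xk \<in> carrier Q" "xl \<in> carrier Q"
    by (simp_all add: z_def x_defs h_closed)
  have z_comm: "z \<otimes> xj = xj \<otimes> z" "z \<otimes> xl = xl \<otimes> z"
    using h_inverse_pair_commute D' by (simp_all add: z_def x_defs)
  \<comment> \<open>The product \<open>z \<otimes> inv xk\<close> is the symbol \<open>h i k\<close>
    at the inverse of \<open>u\<close>; conjugating it by \<open>xj\<close> produces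
    \<open>h i k\<close> at 1, which (R0) removes.\<close>
  have "inv xj \<otimes> (z \<otimes> inv xk) \<otimes> xj = inv xk"
    using conj_h[OF D'(1), of "inv\<^bsub>G\<^esub> u" u]
    by (simp add: z_def x_defs R0 h_closed group_simps)
  then have "xk = inv (inv xj \<otimes> (z \<otimes> inv xk) \<otimes> xj)"
    by simp
  also have "\<dots> = inv xj \<otimes> xk \<otimes> (inv z \<otimes> xj)"
    by (simp add: group_simps)
  also have "\<dots> = inv xj \<otimes> xk \<otimes> (xj \<otimes> inv z)"
    using commute_inv[OF _ _ z_comm(1)] by simp
  finally have "xk \<otimes> (z \<otimes> inv xj) = inv xj \<otimes> xk \<otimes> (xj \<otimes> inv z) \<otimes> (z \<otimes> inv xj)"
    by (metis \<open>z \<in> _\<close> \<open>xj \<in> _\<close> inv_closed m_closed)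
  then have "inv xj \<otimes> xk = xk \<otimes> (z \<otimes> inv xj)"
    by (simp add: group_simps)
  also have "z \<otimes> inv xj = inv xj \<otimes> z"
    using commute_inv[OF _ _ z_comm(1)[symmetric]] by simp
  \<comment> \<open>Exchanging \<open>inv xj\<close> and \<open>xk\<close> costs only the factor
    \<open>z\<close>, which commutes with \<open>xl\<close> as well.\<close>
  finally have swap: "inv xj \<otimes> xk = (xk \<otimes> inv xj) \<otimes> z"
    by (simp add: m_assoc)
  have "xl \<otimes> (xk \<otimes> inv xj) = (xk \<otimes> inv xj) \<otimes> xl"
  proof -
    have "xk \<otimes> inv xj = h j k u"
      by (simp add: x_defs h_closed group_simps flip: h_triangle[OF D'(1)])
    then show ?thesis
      by (simp add: x_defs R3[OF D'(4)])
  qed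
  then have comm: "xl \<otimes> (inv xj \<otimes> xk) = (inv xj \<otimes> xk) \<otimes> xl"
    unfolding swap
    by (metis \<open>z \<in> _\<close> \<open>xj \<in> _\<close> \<open>xk \<in> _\<close> \<open>xl \<in> _\<close> z_comm(2) inv_closed m_assoc m_closed)
  have w: "h l k v \<in> carrier Q"
    by (simp add: h_closed)
  \<comment> \<open>After splitting \<open>h i k v\<close>, the factor \<open>h l k v\<close> moves
    left past \<open>xj\<close> by (R3) and \<open>xl\<close> moves to the far right by
    \<open>comm\<close>. Then \<open>xj\<close> cancels, and what remains is the left side of (R2)
    for \<open>i, l, k\<close>.\<close>
  have "xj \<otimes> h i k v \<otimes> inv xj \<otimes> xk = (xj \<otimes> h l k v) \<otimes> xl \<otimes> (inv xj \<otimes> xk)"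
    using w by (simp add: x_defs(3) m_assoc h_closed flip: h_triangle[OF D'(2)])
  also have "\<dots> = h l k v \<otimes> xj \<otimes> (xl \<otimes> (inv xj \<otimes> xk))"
    using w R3[OF D'(3)] by (simp add: x_defs(1) m_assoc h_closed)
  also have "\<dots> = h l k v \<otimes> xk \<otimes> xl"
    using w by (simp add: comm group_simps)
  also have "\<dots> = h i k (u \<otimes>\<^bsub>G\<^esub> v)"
    by (simp add: x_defs R2[OF D'(2)])
  finally show ?thesis
    by (simp add: x_defs eq_mult_inv_iff h_closed)
qed

end

section \<open>Families in an arbitrary group: from (H1)--(H4) to (R0) and (R2)\<close>

locale H_family = symbol_family +
  assumes H1: "distinct_indices n [i, j] \<Longrightarrow> u \<in> carrier G \<Longrightarrow> h i j u \<otimes> h j i u = \<one>"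
    and H2: "distinct_indices n [i, j, k] \<Longrightarrow> u \<in> carrier G \<Longrightarrow>
      h i j u \<otimes> h k i u \<otimes> h j k u = \<one>"
    and H3: "distinct_indices n [i, j, k] \<Longrightarrow> u \<in> carrier G \<Longrightarrow> v \<in> carrier G \<Longrightarrow>
      h i j u \<otimes> h i k v \<otimes> inv h i j u = h i k (u \<otimes>\<^bsub>G\<^esub> v) \<otimes> inv h i k u"
    and H4: "distinct_indices n [i, j, k] \<Longrightarrow> u \<in> carrier G \<Longrightarrow> v \<in> carrier G \<Longrightarrow>
      h i j u \<otimes> h k j v \<otimes> inv h i j u = h k j (v \<otimes>\<^bsub>G\<^esub> u) \<otimes> inv h k j u"
begin

lemma R0:
  assumes "n \<ge> 3" "distinct_indices n [i, j]"
  shows "h i j \<one>\<^bsub>G\<^esub> = \<one>"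
proof -
  \<comment> \<open>A third index is needed to apply (H3), which for \<open>u = v = 1\<close> makes
    a conjugate of \<open>h i j\<close> at 1 trivial.\<close>
  obtain l where "distinct_indices n [l, i, j]"
    using distinct_indices_extend[OF assms(2)] assms(1) by auto
  then have D: "distinct_indices n [i, l, j]" and [simp]: "distinct_indices n [i, l]"
    by (auto simp: distinct_indices_def)
  have c: "h i l \<one>\<^bsub>G\<^esub> \<in> carrier Q" "h i j \<one>\<^bsub>G\<^esub> \<in> carrier Q"
    using assms by (simp_all add: h_closed)
  have "h i l \<one>\<^bsub>G\<^esub> \<otimes> h i j \<one>\<^bsub>G\<^esub> \<otimes> inv h i l \<one>\<^bsub>G\<^esub> = \<one>"
    using H3[OF D G.one_closed G.one_closed] c by simp
  then show ?thesis
    using c by (metis inv_closed inv_equality inv_inv l_cancel m_assoc m_closed r_one r_inv)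
qed

text \<open>(H2) and (H1) recover the triangle rule. Substituting
  \<open>inv h j k b \<otimes> h i k b\<close> for \<open>h i j b\<close> exposes a conjugate of
  \<open>h i k a\<close> by \<open>h j k b\<close>, which (H4) evaluates.\<close>

lemma R2:
  assumes D: "distinct_indices n [i, j, k]" and [simp]: "a \<in> carrier G" "b \<in> carrier G"
  shows "h j k b \<otimes> h i k a \<otimes> h i j b = h i k (a \<otimes>\<^bsub>G\<^esub> b)"
proof -
  have D': "distinct_indices n [j, k, i]" "distinct_indices n [k, i]"
    and c: "h i j b \<in> carrier Q" "h j k b \<in> carrier Q" "h i k a \<in> carrier Q" "h i k b \<in> carrier Q"
      "h k i b \<in> carrier Q" "h i k (a \<otimes>\<^bsub>G\<^esub> b) \<in> carrier Q"
    using D by (auto simp: distinct_indices_def intro!: h_closed)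
  have "inv h k i b = h j k b \<otimes> h i j b"
    using H2[OF D'(1)] c by (metis \<open>b \<in> _\<close> inv_equality inv_inv m_closed m_assoc inv_comm)
  moreover have "inv h k i b = h i k b"
    using H1[OF D'(2)] c by (metis \<open>b \<in> _\<close> inv_equality inv_comm)
  ultimately have "inv h j k b \<otimes> h i k b = h i j b"
    using c by (simp add: inv_mult_cancel)
  then have "h j k b \<otimes> h i k a \<otimes> h i j b = h j k b \<otimes> h i k a \<otimes> inv h j k b \<otimes> h i k b"
    using c by (simp add: m_assoc)
  then show ?thesis
    using H4[OF D'(1) assms(3,2)] c by (simp add: group_simps)
qed

end


section \<open>Relators in kernels as equations between images\<close>

lemma (in group) relator_closed:
  "x \<in> carrier G \<Longrightarrow> y \<in> carrier G \<Longrightarrow> relator G x y \<in> carrier G"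
  by (simp add: relator_def)

lemma (in group) commutator_closed:
  "x \<in> carrier G \<Longrightarrow> y \<in> carrier G \<Longrightarrow> commutator G x y \<in> carrier G"
  by (simp add: commutator_def)

text \<open>Presents every normal subgroup as a kernel, so that containing relators becomes
  satisfying equations in the quotient.\<close>

lemma (in normal) kernel_r_coset: "kernel G (G Mod H) ((#>) H) = H"
proof -
  have "H #> x = H \<longleftrightarrow> x \<in> H" if "x \<in> carrier G" for x
    using that by (metis coset_join1 coset_join2 is_subgroup subset)
  then show ?thesis
    using subset by (auto simp: kernel_def)
qed

lemma (in group_hom) relator_mem_kernel_iff:
  assumes "x \<in> carrier G" "y \<in> carrier G"
  shows "relator G x y \<in> kernel G H h \<longleftrightarrow> h x = h y"
proof -
  have "h x \<otimes>\<^bsub>H\<^esub> inv\<^bsub>H\<^esub> h y = \<one>\<^bsub>H\<^esub> \<longleftrightarrow> h x = h y"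
    using assms by (metis H.eq_mult_inv_iff H.l_one H.one_closed hom_closed)
  then show ?thesis
    using assms by (simp add: kernel_def relator_def)
qed

lemma (in group_hom) hom_commutator:
  assumes "x \<in> carrier G" "y \<in> carrier G"
  shows "h (commutator G x y) = commutator H (h x) (h y)"
  using assms by (simp add: commutator_def)

lemma group_h_free: "group (h_free G n)"
  by (simp add: h_free_def group_free_group)

lemma hsym_closed:
  "i \<in> {1..n} \<Longrightarrow> j \<in> {1..n} \<Longrightarrow> i \<noteq> j \<Longrightarrow> u \<in> carrier G \<Longrightarrow> hsym i j u \<in> carrier (h_free G n)"
  unfolding hsym_def h_free_def by (rule free_gen_closed) (auto simp: h_symbols_def)

lemma R1_eq_H1: "R1 G n = H1 G n"
  by (simp add: R1_def H1_def)

lemma R3_eq_H5: "R3 G n = H5 G n"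
  by (simp add: R3_def H5_def)

text \<open>The images of the symbols under \<open>p\<close> form the family to which the
  computations above apply.\<close>

locale h_free_hom = G: group G + p: group_hom "h_free G n" Q p
  for G :: "('g, 'm) monoid_scheme" and n :: nat and Q :: "('q, 'k) monoid_scheme" (structure) and p
begin

abbreviation (input) h where "h i j u \<equiv> p (hsym i j u)"
abbreviation (input) N where "N \<equiv> kernel (h_free G n) Q p"

lemmas relation_simps = p.relator_mem_kernel_iff hsym_closed p.hom_commutator
  p.G.commutator_closed p.H.commutator_eq_one_iff distinct_indices_def

lemma R0_iff:
  "R0 G n \<subseteq> N \<longleftrightarrow> (\<forall>i j. distinct_indices n [i, j] \<longrightarrow>
    h i j \<one>\<^bsub>G\<^esub> = \<one>)"
  unfolding R0_def subset_iff mem_Collect_eq imp_ex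
  by (simp add: relation_simps cong: imp_cong)

lemma R1_iff:
  "R1 G n \<subseteq> N \<longleftrightarrow> (\<forall>i j a. distinct_indices n [i, j] \<and> a \<in> carrier G \<longrightarrow>
    h i j a \<otimes> h j i a = \<one>)"
  unfolding R1_def subset_iff mem_Collect_eq imp_ex
  by (simp add: relation_simps cong: imp_cong)

lemma R2_iff:
  "R2 G n \<subseteq> N \<longleftrightarrow> (\<forall>i j k a b. distinct_indices n [i, j, k] \<and> a \<in> carrier G \<and> b \<in> carrier G \<longrightarrow>
    h j k b \<otimes> h i k a \<otimes> h i j b = h i k (a \<otimes>\<^bsub>G\<^esub> b))"
  unfolding R2_def subset_iff mem_Collect_eq imp_ex
  by (simp add: relation_simps cong: imp_cong)

lemma R3_iff:
  "R3 G n \<subseteq> N \<longleftrightarrow> (\<forall>i j k l a b. distinct_indices n [i, j, k, l] \<and> a \<in> carrier G \<and> b \<in> carrier G \<longrightarrow>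
    h i j a \<otimes> h k l b = h k l b \<otimes> h i j a)"
  unfolding R3_def subset_iff mem_Collect_eq imp_ex
  by (simp add: relation_simps cong: imp_cong)

lemma R4_iff:
  "R4 G n \<subseteq> N \<longleftrightarrow> (\<forall>i j a. distinct_indices n [i, j] \<and> a \<in> carrier G \<longrightarrow>
    inv h i j a = h i j (inv\<^bsub>G\<^esub> a))"
  unfolding R4_def subset_iff mem_Collect_eq imp_ex
  by (simp add: relation_simps cong: imp_cong)

lemma H1_iff:
  "H1 G n \<subseteq> N \<longleftrightarrow> (\<forall>i j u. distinct_indices n [i, j] \<and> u \<in> carrier G \<longrightarrow>
    h i j u \<otimes> h j i u = \<one>)"
  unfolding H1_def subset_iff mem_Collect_eq imp_ex
  by (simp add: relation_simps cong: imp_cong)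

lemma H2_iff:
  "H2 G n \<subseteq> N \<longleftrightarrow> (\<forall>i j k u. distinct_indices n [i, j, k] \<and> u \<in> carrier G \<longrightarrow>
    h i j u \<otimes> h k i u \<otimes> h j k u = \<one>)"
  unfolding H2_def subset_iff mem_Collect_eq imp_ex
  by (simp add: relation_simps cong: imp_cong)

lemma H3_iff:
  "H3 G n \<subseteq> N \<longleftrightarrow> (\<forall>i j k u v. distinct_indices n [i, j, k] \<and> u \<in> carrier G \<and> v \<in> carrier G \<longrightarrow>
    h i j u \<otimes> h i k v \<otimes> inv h i j u = h i k (u \<otimes>\<^bsub>G\<^esub> v) \<otimes> inv h i k u)"
  unfolding H3_def subset_iff mem_Collect_eq imp_ex
  by (simp add: relation_simps cong: imp_cong)

lemma H4_iff:
  "H4 G n \<subseteq> N \<longleftrightarrow> (\<forall>i j k u v. distinct_indices n [i, j, k] \<and> u \<in> carrier G \<and> v \<in> carrier G \<longrightarrow>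
    h i j u \<otimes> h k j v \<otimes> inv h i j u = h k j (v \<otimes>\<^bsub>G\<^esub> u) \<otimes> inv h k j u)"
  unfolding H4_def subset_iff mem_Collect_eq imp_ex
  by (simp add: relation_simps cong: imp_cong)

lemma symbol_family_h: "symbol_family Q G n h"
  by unfold_locales (auto simp: distinct_indices_def hsym_closed)

lemma R_family_h:
  assumes "R0 G n \<union> R1 G n \<union> R2 G n \<union> R3 G n \<subseteq> N"
  shows "R_family Q G n h"
proof -
  interpret symbol_family Q G n h by (rule symbol_family_h)
  have rel: "R0 G n \<subseteq> N" "R1 G n \<subseteq> N" "R2 G n \<subseteq> N" "R3 G n \<subseteq> N"
    using assms by simp_all
  note rules = rel(1)[unfolded R0_iff, rule_format]
      rel(2)[unfolded R1_iff, rule_format]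
      rel(3)[unfolded R2_iff, rule_format]
      rel(4)[unfolded R3_iff, rule_format]
  show ?thesis
    by unfold_locales (rule rules; simp)+
qed

lemma H_family_h:
  assumes "H1 G n \<union> H2 G n \<union> H3 G n \<union> H4 G n \<subseteq> N"
  shows "H_family Q G n h"
proof -
  interpret symbol_family Q G n h by (rule symbol_family_h)
  have rel: "H1 G n \<subseteq> N" "H2 G n \<subseteq> N" "H3 G n \<subseteq> N" "H4 G n \<subseteq> N"
    using assms by simp_all
  note rules = rel(1)[unfolded H1_iff, rule_format]
      rel(2)[unfolded H2_iff, rule_format]
      rel(3)[unfolded H3_iff, rule_format]
      rel(4)[unfolded H4_iff, rule_format]
  show ?thesis
    by unfold_locales (rule rules; simp)+
qed

text \<open>The disjunction serves both claims: (H3) is the only relation whose derivation differs,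
  using either a fourth index or (R4).\<close>

lemma H_subset_kernel:
  assumes R: "R0 G n \<union> R1 G n \<union> R2 G n \<union> R3 G n \<subseteq> N" and n: "n \<ge> 4 \<or> R4 G n \<subseteq> N"
  shows "H1 G n \<union> H2 G n \<union> H3 G n \<union> H4 G n \<union> H5 G n \<subseteq> N"
proof -
  interpret R_family Q G n h by (rule R_family_h[OF R])
  have "h i j u \<otimes> h i k v \<otimes> inv h i j u = h i k (u \<otimes>\<^bsub>G\<^esub> v) \<otimes> inv h i k u"
    if D: "distinct_indices n [i, j, k]" and uv: "u \<in> carrier G" "v \<in> carrier G" for i j k u v
    using n
  proof
    assume "n \<ge> 4"
    then obtain l where "distinct_indices n [l, i, j, k]"
      using distinct_indices_extend[OF D] by auto
    then show ?thesis
      using uv by (rule H3_of_four_indices)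
  next
    assume "R4 G n \<subseteq> N"
    then show ?thesis
      by (intro H3_of_R4 D uv) (simp add: R4_iff)
  qed
  then show ?thesis
    using R H2 H4 by (simp add: H2_iff H3_iff H4_iff flip: R1_eq_H1 R3_eq_H5)
qed

lemma R_subset_kernel:
  assumes H: "H1 G n \<union> H2 G n \<union> H3 G n \<union> H4 G n \<union> H5 G n \<subseteq> N" and n: "n \<ge> 3"
  shows "R0 G n \<union> R1 G n \<union> R2 G n \<union> R3 G n \<subseteq> N"
proof -
  interpret H_family Q G n h by (rule H_family_h) (use H in blast)
  show ?thesis
    using H R0[OF n] R2 by (simp add: R0_iff R2_iff R1_eq_H1 R3_eq_H5)
qed

end

section \<open>From quotients to normal closures\<close>

lemma h_free_hom_quotient:
  assumes "group G" "N \<lhd> h_free G n"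
  shows "h_free_hom G n (h_free G n Mod N) (\<lambda>x. N #>\<^bsub>h_free G n\<^esub> x)"
proof -
  interpret N: normal N "h_free G n" by fact
  show ?thesis
    using assms(1) N.factorgroup_is_group N.r_coset_hom_Mod
    by (simp add: h_free_hom_def group_hom_def group_hom_axioms_def group_h_free)
qed

lemma relators_closed:
  assumes "group G"
  shows "R0 G n \<union> R1 G n \<union> R2 G n \<union> R3 G n \<union> R4 G n \<subseteq> carrier (h_free G n)"
    and "H1 G n \<union> H2 G n \<union> H3 G n \<union> H4 G n \<union> H5 G n \<subseteq> carrier (h_free G n)"
proof -
  interpret G: group G by fact
  interpret F: group "h_free G n" by (rule group_h_free)
  show "R0 G n \<union> R1 G n \<union> R2 G n \<union> R3 G n \<union> R4 G n \<subseteq> carrier (h_free G n)"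
    by (auto simp: R0_def R1_def R2_def R3_def R4_def distinct_indices_def
        intro!: F.relator_closed F.commutator_closed F.m_closed hsym_closed)
  show "H1 G n \<union> H2 G n \<union> H3 G n \<union> H4 G n \<union> H5 G n \<subseteq> carrier (h_free G n)"
    by (auto simp: H1_def H2_def H3_def H4_def H5_def distinct_indices_def
        intro!: F.relator_closed F.commutator_closed F.m_closed hsym_closed)
qed

theorem proposition3p3:
  fixes G :: "('g, 'm) monoid_scheme" and n :: nat
  assumes "group G"
  shows "(n \<ge> 3 \<longrightarrow>
            normal_closure (h_free G n) (H1 G n \<union> H2 G n \<union> H3 G n \<union> H4 G n \<union> H5 G n)
            \<subseteq> normal_closure (h_free G n) (R0 G n \<union> R1 G n \<union> R2 G n \<union> R3 G n \<union> R4 G n)) \<and>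
         (n \<ge> 4 \<longrightarrow>
            normal_closure (h_free G n) (R0 G n \<union> R1 G n \<union> R2 G n \<union> R3 G n)
            = normal_closure (h_free G n) (H1 G n \<union> H2 G n \<union> H3 G n \<union> H4 G n \<union> H5 G n))"
    (is "(_ \<longrightarrow> ?cl ?H \<subseteq> ?cl (?R \<union> ?R4)) \<and> (_ \<longrightarrow> _)")
proof (intro conjI impI equalityI)
  have closed: "?R \<union> ?R4 \<subseteq> carrier (h_free G n)" "?H \<subseteq> carrier (h_free G n)"
    by (rule relators_closed[OF assms])+
  \<comment> \<open>Since a normal closure is the least normal subgroup containing its relators, it
    suffices to take for \<open>M\<close> the normal closure of the other list; \<open>M\<close> is
    the kernel of its quotient map.\<close>
  have H_subset: "?H \<subseteq> M" if "M \<lhd> h_free G n" "?R \<subseteq> M" "n \<ge> 4 \<or> ?R4 \<subseteq> M" for M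
    using h_free_hom.H_subset_kernel[OF h_free_hom_quotient[OF assms that(1)]]
      normal.kernel_r_coset[OF that(1)] that(2,3) by simp
  have R_subset: "?R \<subseteq> M" if "M \<lhd> h_free G n" "?H \<subseteq> M" "n \<ge> 3" for M
    using h_free_hom.R_subset_kernel[OF h_free_hom_quotient[OF assms that(1)]]
      normal.kernel_r_coset[OF that(1)] that(2,3) by simp
  show "?cl ?H \<subseteq> ?cl (?R \<union> ?R4)"
  proof -
    note cl = normal_normal_closure[OF group_h_free closed(1)]
    show ?thesis
      using cl(2) by (intro normal_closure_least H_subset cl(1)) simp_all
  qed
  assume n: "n \<ge> 4"
  show "?cl ?H \<subseteq> ?cl ?R"
  proof -
    have "?R \<subseteq> carrier (h_free G n)"
      using closed(1) by simp
    note cl = normal_normal_closure[OF group_h_free this]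
    show ?thesis
      using cl(2) n by (intro normal_closure_least H_subset cl(1)) simp_all
  qed
  show "?cl ?R \<subseteq> ?cl ?H"
  proof -
    note cl = normal_normal_closure[OF group_h_free closed(2)]
    show ?thesis
      using cl(2) n by (intro normal_closure_least R_subset cl(1)) simp_all
  qed
qed

end
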